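(* Let $\mathcal{D}$ be a data set of $N$ observations, with legitimate features marked $(\uparrow)$ or $(\downarrow)$, and let $\alpha\in(0,1)$. Suppose the observations of $\mathcal{D}$ are ranked and classified by the fair ranking-based classification algorithm described in the context. Then meritocratic unfairness does not occur: there are no two observations $(i)$, $(j)$ of $\mathcal{D}$ such that $(i)$ is more qualified than $(j)$ but (a) $(i)$ is ranked lower than $(j)$, or (b) $(i)$ is assigned the negative outcome $(-)$ while $(j)$ is assigned the positive outcome $(+)$.
   Context: Data. $\mathcal{D}$ consists of $N$ observations; observation $(i)$ has real-valued protected features $a_1^{(i)},\dots,a_K^{(i)}$ and real-valued legitimate features $x_1^{(i)},\dots,x_L^{(i)}$. Each legitimate feature $x_\ell$ is marked either $(\uparrow)$ (higher values are beneficial with respect to the positive outcome) or $(\downarrow)$ (lower values are beneficial). No feature is constant over $\mathcal{D}$, so that the quantities below are well defined. Scaling. For each $\ell$ and $i$, set $z_\ell^{(i)} = \dfrac{x_\ell^{(i)}-\min_j x_\ell^{(j)}}{\max_j x_\ell^{(j)}-\min_j x_\ell^{(j)}}$ if $x_\ell$ is $(\uparrow)$, and $z_\ell^{(i)} = 1-\dfrac{x_\ell^{(i)}-\min_j x_\ell^{(j)}}{\max_j x_\ell^{(j)}-\min_j x_\ell^{(j)}}$ if $x_\ell$ is $(\downarrow)$. Thus $z_\ell^{(i)}\in[0,1]$. Weights. The feature importances are given real numbers $\omega_1,\dots,\omega_L\ge 0$ with $\sum_{\ell=1}^L\omega_\ell=1$. Further, $\widetilde{\rho}_\ell=\max_{k\in\{1,\dots,K\}}|\rho_{a_k,z_\ell}|\in[0,1]$,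 where $\rho_{a_k,z_\ell}$ is Spearman's rank correlation coefficient between the samples $a_k$ and $z_\ell$ over $\mathcal{D}$. Distance to the North Star. The North Star $(\star)$ is the (potentially hypothetical) observation with $z_\ell^{(\star)}=1$ for all $\ell$, and $d''(i,\star)=\sum_{\ell=1}^L\omega_\ell(1-\widetilde{\rho}_\ell)\bigl(1-z_\ell^{(i)}\bigr)$. Algorithm. Rank the $N$ observations of $\mathcal{D}$ in order of nondecreasing distance $d''(\cdot,\star)$ (ties broken arbitrarily), so that the observation with the smallest distance is ranked highest and the one with the largest distance is ranked lowest. Put $\nu=\lceil\alpha N\rceil$. Assign the positive outcome $(+)$ to the $\nu$ highest-ranked observations and the negative outcome $(-)$ to the rest. Higher qualification. Observation $(i)$ is more qualified than $(j)$ if, according to the $(\uparrow)$ or $(\downarrow)$ markings, $(i)$ is better than or equal to $(j)$ for all legitimate features (i.e. $x_\ell^{(i)}\ge x_\ell^{(j)}$ if $x_\ell$ is $(\uparrow)$, and $x_\ell^{(i)}\le x_\ell^{(j)}$ if $x_\ell$ is $(\downarrow)$) and strictly better for at least one $\ell'\in\{1,\dots,L\}$ with $\omega_{\ell'}\neq 0$ and $\widetilde{\rho}_{\ell'}\neq 1$. *)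

theory Defs
  imports Complex_Main
begin

definition mean :: "'i set \<Rightarrow> ('i \<Rightarrow> real) \<Rightarrow> real" where
  "mean I u = (\<Sum>i\<in>I. u i) / real (card I)"

definition pearson :: "'i set \<Rightarrow> ('i \<Rightarrow> real) \<Rightarrow> ('i \<Rightarrow> real) \<Rightarrow> real" where
  "pearson I u v =
     (\<Sum>i\<in>I. (u i - mean I u) * (v i - mean I v)) /
     (sqrt (\<Sum>i\<in>I. (u i - mean I u)\<^sup>2) * sqrt (\<Sum>i\<in>I. (v i - mean I v)\<^sup>2))"

text \<open>Ascending fractional ranks: tied values share the average of the positions
  they occupy. With \<open>s\<close> strictly smaller values and \<open>t\<close> tied ones (itself included) the
  positions are \<open>s + 1, \<dots>, s + t\<close>, whose average is \<open>s + (t + 1) / 2\<close>.\<close>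

definition frac_rank :: "'i set \<Rightarrow> ('i \<Rightarrow> real) \<Rightarrow> 'i \<Rightarrow> real" where
  "frac_rank I u i =
     real (card {j \<in> I. u j < u i}) + (real (card {j \<in> I. u j = u i}) + 1) / 2"

definition spearman :: "'i set \<Rightarrow> ('i \<Rightarrow> real) \<Rightarrow> ('i \<Rightarrow> real) \<Rightarrow> real" where
  "spearman I u v = pearson I (frac_rank I u) (frac_rank I v)"

datatype direction = Up | Down

datatype outcome = Positive | Negative

text \<open>Observations, protected features and legitimate features are numbered from 1;
  \<open>protected D k i\<close> and \<open>legit D l i\<close> are the values of the respective feature at
  observation \<open>i\<close>, and \<open>marking D l\<close> tells which values of the \<open>l\<close>-th legitimate
  feature are beneficial.\<close>

record dataset =
  num_obs :: nat
  num_protected :: nat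
  num_legit :: nat
  protected :: "nat \<Rightarrow> nat \<Rightarrow> real"
  legit :: "nat \<Rightarrow> nat \<Rightarrow> real"
  marking :: "nat \<Rightarrow> direction"

definition observations :: "dataset \<Rightarrow> nat set" where
  "observations D = {1..num_obs D}"

definition nonconstant_features :: "dataset \<Rightarrow> bool" where
  "nonconstant_features D \<longleftrightarrow>
     (\<forall>k\<in>{1..num_protected D}.
        \<exists>i\<in>observations D. \<exists>j\<in>observations D. protected D k i \<noteq> protected D k j) \<and>
     (\<forall>l\<in>{1..num_legit D}.
        \<exists>i\<in>observations D. \<exists>j\<in>observations D. legit D l i \<noteq> legit D l j)"

definition min_max :: "dataset \<Rightarrow> nat \<Rightarrow> nat \<Rightarrow> real" where
  "min_max D l i =
     (legit D l i - Min (legit D l ` observations D)) /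
     (Max (legit D l ` observations D) - Min (legit D l ` observations D))"

definition scaled :: "dataset \<Rightarrow> nat \<Rightarrow> nat \<Rightarrow> real" where
  "scaled D l i =
     (case marking D l of Up \<Rightarrow> min_max D l i | Down \<Rightarrow> 1 - min_max D l i)"

definition max_corr :: "dataset \<Rightarrow> nat \<Rightarrow> real" where
  "max_corr D l =
     Max ((\<lambda>k. \<bar>spearman (observations D) (protected D k) (scaled D l)\<bar>) ` {1..num_protected D})"

definition feature_importances :: "dataset \<Rightarrow> (nat \<Rightarrow> real) \<Rightarrow> bool" where
  "feature_importances D \<omega> \<longleftrightarrow>
     (\<forall>l\<in>{1..num_legit D}. \<omega> l \<ge> 0) \<and> (\<Sum>l=1..num_legit D. \<omega> l) = 1"

text \<open>The North Star has scaled value 1 in every legitimate feature.\<close>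

definition dist_north_star :: "dataset \<Rightarrow> (nat \<Rightarrow> real) \<Rightarrow> nat \<Rightarrow> real" where
  "dist_north_star D \<omega> i =
     (\<Sum>l=1..num_legit D. \<omega> l * (1 - max_corr D l) * (1 - scaled D l i))"

text \<open>\<open>r i\<close> is the position of observation \<open>i\<close>, position 1 being the highest.\<close>

definition fair_ranking :: "dataset \<Rightarrow> (nat \<Rightarrow> real) \<Rightarrow> (nat \<Rightarrow> nat) \<Rightarrow> bool" where
  "fair_ranking D \<omega> r \<longleftrightarrow>
     bij_betw r (observations D) {1..num_obs D} \<and>
     (\<forall>i\<in>observations D. \<forall>j\<in>observations D.
        r i \<le> r j \<longrightarrow> dist_north_star D \<omega> i \<le> dist_north_star D \<omega> j)"

definition ranked_lower :: "(nat \<Rightarrow> nat) \<Rightarrow> nat \<Rightarrow> nat \<Rightarrow> bool" where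
  "ranked_lower r i j \<longleftrightarrow> r i > r j"

text \<open>Since ties are broken arbitrarily, the algorithm is a relation between its input
  \<open>(D, \<omega>, \<alpha>)\<close> and all its possible outputs: a ranking \<open>r\<close> and a classification \<open>c\<close>.\<close>

definition fair_classification ::
    "dataset \<Rightarrow> (nat \<Rightarrow> real) \<Rightarrow> real \<Rightarrow> (nat \<Rightarrow> nat) \<Rightarrow> (nat \<Rightarrow> outcome) \<Rightarrow> bool" where
  "fair_classification D \<omega> \<alpha> r c \<longleftrightarrow>
     fair_ranking D \<omega> r \<and>
     (\<forall>i\<in>observations D.
        c i = (if int (r i) \<le> \<lceil>\<alpha> * real (num_obs D)\<rceil> then Positive else Negative))"

definition at_least_as_good :: "dataset \<Rightarrow> nat \<Rightarrow> nat \<Rightarrow> nat \<Rightarrow> bool" where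
  "at_least_as_good D l i j \<longleftrightarrow>
     (case marking D l of Up \<Rightarrow> legit D l i \<ge> legit D l j | Down \<Rightarrow> legit D l i \<le> legit D l j)"

definition strictly_better :: "dataset \<Rightarrow> nat \<Rightarrow> nat \<Rightarrow> nat \<Rightarrow> bool" where
  "strictly_better D l i j \<longleftrightarrow>
     (case marking D l of Up \<Rightarrow> legit D l i > legit D l j | Down \<Rightarrow> legit D l i < legit D l j)"

definition more_qualified :: "dataset \<Rightarrow> (nat \<Rightarrow> real) \<Rightarrow> nat \<Rightarrow> nat \<Rightarrow> bool" where
  "more_qualified D \<omega> i j \<longleftrightarrow>
     (\<forall>l\<in>{1..num_legit D}. at_least_as_good D l i j) \<and>
     (\<exists>l\<in>{1..num_legit D}. strictly_better D l i j \<and> \<omega> l \<noteq> 0 \<and> max_corr D l \<noteq> 1)"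

definition meritocratic_unfairness ::
    "dataset \<Rightarrow> (nat \<Rightarrow> real) \<Rightarrow> (nat \<Rightarrow> nat) \<Rightarrow> (nat \<Rightarrow> outcome) \<Rightarrow> bool" where
  "meritocratic_unfairness D \<omega> r c \<longleftrightarrow>
     (\<exists>i\<in>observations D. \<exists>j\<in>observations D.
        more_qualified D \<omega> i j \<and>
        (ranked_lower r i j \<or> c i = Negative \<and> c j = Positive))"

end

theory Submission
  imports Defs "HOL-Analysis.L2_Norm"
begin

text \<open>The distance to the North Star is a sum of terms
  \<open>\<omega> l * (1 - max_corr D l) * (1 - scaled D l i)\<close> whose coefficients are nonnegative by the
  Cauchy--Schwarz inequality. Min-max scaling is strictly monotone in the beneficial direction, so
  a more qualified observation has a strictly smaller distance. It is therefore ranked strictly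
  higher, and the positive outcomes go to an initial segment of the ranking.\<close>

lemma abs_pearson_le_1: "\<bar>pearson I u v\<bar> \<le> 1"
proof -
  let ?u = "\<lambda>i. u i - mean I u" and ?v = "\<lambda>i. v i - mean I v"
  have "\<bar>\<Sum>i\<in>I. ?u i * ?v i\<bar> \<le> (\<Sum>i\<in>I. \<bar>?u i\<bar> * \<bar>?v i\<bar>)"
    using sum_abs[of "\<lambda>i. ?u i * ?v i" I] by (simp add: abs_mult)
  also have "\<dots> \<le> L2_set ?u I * L2_set ?v I"
    by (rule L2_set_mult_ineq)
  finally show ?thesis
    \<comment> \<open>The square roots in the denominator are the L2 norms of the deviations, so the
      bound above is the claim cleared of its denominator. If one norm is 0, the quotient is 0 by
      the convention \<open>x / 0 = 0\<close>.\<close>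
    unfolding pearson_def L2_set_def[symmetric]
    by (auto simp: abs_mult divide_le_eq_1 less_le)
qed

text \<open>A protected feature exists, so \<open>Max\<close> ranges over a nonempty set; each
  member is bounded because Spearman's coefficient is Pearson's applied to ranks.\<close>

lemma max_corr_le_1:
  assumes "num_protected D \<ge> 1"
  shows "max_corr D l \<le> 1"
  using assms unfolding max_corr_def spearman_def
  by (subst Max_le_iff) (auto simp: abs_pearson_le_1)

text \<open>Makes the denominator of \<open>min_max\<close> positive, so that scaling is an affine
  map of positive slope, reflected for \<open>Down\<close>.\<close>

lemma Min_less_Max_legit:
  assumes "nonconstant_features D" "l \<in> {1..num_legit D}"
  shows "Min (legit D l ` observations D) < Max (legit D l ` observations D)"
proof -
  let ?X = "legit D l ` observations D"
  have fin: "finite ?X" by (simp add: observations_def)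
  obtain i j where "i \<in> observations D" "j \<in> observations D" "legit D l i \<noteq> legit D l j"
    using assms unfolding nonconstant_features_def by blast
  then obtain x y where "x \<in> ?X" "y \<in> ?X" "x < y"
    by (metis image_eqI linorder_neqE_linordered_idom)
  then show ?thesis
    using Min_le[OF fin, of x] Max_ge[OF fin, of y] by linarith
qed

lemma scaled_le_iff_at_least_as_good:
  assumes "nonconstant_features D" "l \<in> {1..num_legit D}"
  shows "scaled D l j \<le> scaled D l i \<longleftrightarrow> at_least_as_good D l i j"
  using Min_less_Max_legit[OF assms]
  by (cases "marking D l")
    (simp_all add: scaled_def at_least_as_good_def min_max_def divide_le_cancel)

lemma scaled_less_iff_strictly_better:
  assumes "nonconstant_features D" "l \<in> {1..num_legit D}"
  shows "scaled D l j < scaled D l i \<longleftrightarrow> strictly_better D l i j"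
  using Min_less_Max_legit[OF assms]
  by (cases "marking D l")
    (simp_all add: scaled_def strictly_better_def min_max_def divide_less_cancel)

lemma more_qualified_dist_north_star_less:
  assumes "num_protected D \<ge> 1" "nonconstant_features D" "feature_importances D \<omega>"
    and "more_qualified D \<omega> i j"
  shows "dist_north_star D \<omega> i < dist_north_star D \<omega> j"
  unfolding dist_north_star_def
proof (rule sum_strict_mono_ex1)
  show "\<forall>l\<in>{1..num_legit D}. \<omega> l * (1 - max_corr D l) * (1 - scaled D l i)
      \<le> \<omega> l * (1 - max_corr D l) * (1 - scaled D l j)"
  proof
    fix l assume l: "l \<in> {1..num_legit D}"
    have "scaled D l j \<le> scaled D l i"
      using assms(4) l scaled_le_iff_at_least_as_good[OF assms(2) l]
      by (simp add: more_qualified_def)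
    moreover have "0 \<le> \<omega> l * (1 - max_corr D l)"
      using assms(3) l max_corr_le_1[OF assms(1), of l] by (simp add: feature_importances_def)
    ultimately show "\<omega> l * (1 - max_corr D l) * (1 - scaled D l i)
        \<le> \<omega> l * (1 - max_corr D l) * (1 - scaled D l j)"
      by (intro mult_left_mono) simp_all
  qed
  obtain l where l: "l \<in> {1..num_legit D}"
    and better: "strictly_better D l i j" and nz: "\<omega> l \<noteq> 0" "max_corr D l \<noteq> 1"
    using assms(4) unfolding more_qualified_def by blast
  have "scaled D l j < scaled D l i"
    using better scaled_less_iff_strictly_better[OF assms(2) l] by simp
  \<comment> \<open>The two side conditions on the witness in \<open>more_qualified\<close> exclude
    exactly a vanishing coefficient.\<close>
  moreover have "0 < \<omega> l * (1 - max_corr D l)"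
    using assms(3) l nz max_corr_le_1[OF assms(1), of l]
    by (simp add: feature_importances_def less_le)
  ultimately show "\<exists>l\<in>{1..num_legit D}. \<omega> l * (1 - max_corr D l) * (1 - scaled D l i)
      < \<omega> l * (1 - max_corr D l) * (1 - scaled D l j)"
    using l by (intro bexI[of _ l] mult_strict_left_mono) simp_all
qed simp

theorem corollary1:
  fixes D :: dataset and \<omega> :: "nat \<Rightarrow> real" and \<alpha> :: real
    and r :: "nat \<Rightarrow> nat" and c :: "nat \<Rightarrow> outcome"
  assumes "num_protected D \<ge> 1"
    and "nonconstant_features D"
    and "feature_importances D \<omega>"
    and "0 < \<alpha>" and "\<alpha> < 1"
    and "fair_classification D \<omega> \<alpha> r c"
  shows "\<not> meritocratic_unfairness D \<omega> r c"
proof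
  assume "meritocratic_unfairness D \<omega> r c"
  then obtain i j where ij: "i \<in> observations D" "j \<in> observations D"
    and mq: "more_qualified D \<omega> i j"
    and unfair: "r j < r i \<or> c i = Negative \<and> c j = Positive"
    unfolding meritocratic_unfairness_def ranked_lower_def by blast
  have "dist_north_star D \<omega> i < dist_north_star D \<omega> j"
    using more_qualified_dist_north_star_less[OF assms(1-3) mq] .
  \<comment> \<open>The ranking condition with \<open>i\<close> and \<open>j\<close> exchanged; its
    contrapositive applies. Tie-breaking cannot interfere, as the two distances differ.\<close>
  moreover have "r j \<le> r i \<longrightarrow> dist_north_star D \<omega> j \<le> dist_north_star D \<omega> i"
    using assms(6) ij unfolding fair_classification_def fair_ranking_def by blast
  ultimately have "r i < r j" by linarith
  \<comment> \<open>If \<open>c j = Positive\<close>, then \<open>r j\<close> is within the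
    threshold, hence so is the smaller \<open>r i\<close>, and
    \<open>c i = Positive\<close>.\<close>
  with unfair ij assms(6) show False
    unfolding fair_classification_def by (auto split: if_splits)
qed

end
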